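(* Let $Q(\mathbf{Z})\leftarrow R_1(\mathbf{Z}_1)\Join\dots\Join R_k(\mathbf{Z}_k)$ be a full conjunctive query, $\mathbf{PC}=\{PC_{P_i}(\mathcal{X}_i,\mathbf{Y}_i,d_i)\mid i=1,\dots,l\}$ a set of partition constraints on the relations of $Q$ (each $P_i\in\{R_1,\dots,R_k\}$), and $CB$ a cardinality bound for degree constraints with extension $CB(Q,\mathbf{PC})$ to partition constraints. Then $$|Q^I|\le CB(Q,\mathbf{PC})\qquad\text{for all } I\vDash\mathbf{PC}.$$
   Context: A (full) conjunctive query is $Q(\mathbf{Z})\leftarrow R_1(\mathbf{Z}_1)\Join\dots\Join R_k(\mathbf{Z}_k)$ with $\mathbf{Z}=\bigcup_i\mathbf{Z}_i$, where $R_i$ is a relation over the variables $\mathbf{Z}_i$. A database instance $I$ gives a concrete finite set of tuples for each $R_i$; $Q^I$ is the natural join of these. $\pi,\sigma$ denote projection and selection. Degree constraint: for a relation $R(\mathbf{Z}')$ and $\mathbf{X}\subseteq\mathbf{Y}\subseteq\mathbf{Z}'$, $DC_R(\mathbf{X},\mathbf{Y},d)$ asserts $\max_{\mathbf{x}}|\pi_{\mathbf{Y}}\sigma_{\mathbf{X}=\mathbf{x}}R|\le d$ (maximum over all assignments $\mathbf{x}$ of values to $\mathbf{X}$); $DC_R(\mathbf{X},\mathbf{Y})$ is the least such $d$. Partition constraint: for $\mathbf{Y}\subseteq\mathbf{Z}'$ and $\mathcal{X}\subseteq 2^{\mathbf{Y}}$, $PC_R(\mathcal{X},\mathbf{Y},d)$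 asserts $\min_{(R^{\mathbf{X}})_{\mathbf{X}\in\mathcal{X}}}\max_{\mathbf{X}\in\mathcal{X}}DC_{R^{\mathbf{X}}}(\mathbf{X},\mathbf{Y})\le d$, the minimum being over all families of pairwise disjoint (possibly empty) subrelations with union $R$. $I\vDash\mathbf{DC}$ (resp. $I\vDash\mathbf{PC}$) means $I$ satisfies all constraints in the set. Cardinality bound: a function $CB(Q,\mathbf{DC})$ of a conjunctive query $Q$ and a set $\mathbf{DC}$ of degree constraints such that $|Q^I|\le CB(Q,\mathbf{DC})$ for all $I\vDash\mathbf{DC}$. Extension to partition constraints: $$CB(Q,\mathbf{PC}):=\sum_{\mathbf{X}^1\in\mathcal{X}_1,\dots,\mathbf{X}^l\in\mathcal{X}_l}CB\big(Q,\{DC_{P_1}(\mathbf{X}^1,\mathbf{Y}_1,d_1),\dots,DC_{P_l}(\mathbf{X}^l,\mathbf{Y}_l,d_l)\}\big).$$ Standing assumption: every variable in the query is covered by at least one cardinality constraint (a constraint $DC_R(\emptyset,\mathbf{Z}',d)$ for a relation $R(\mathbf{Z}')$), so bounds are finite. *)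

theory Defs
  imports Complex_Main "HOL-Library.Extended_Nat" "HOL-Library.FuncSet" "HOL-Library.Disjoint_Sets"
begin

text \<open>
  A full conjunctive query is given by the list of the variable sets of its atoms; the relation
  of the \<open>i\<close>-th atom is referred to by its index \<open>i\<close>. A tuple over a set of variables \<open>Z\<close> is a
  partial map with domain \<open>Z\<close>.
\<close>

type_synonym 'v query = "'v set list"
type_synonym ('v, 'a) relation = "('v \<rightharpoonup> 'a) set"
type_synonym ('v, 'a) db_instance = "nat \<Rightarrow> ('v, 'a) relation"

definition wf_query :: "'v query \<Rightarrow> bool" where
  "wf_query Q \<longleftrightarrow> Q \<noteq> [] \<and> (\<forall>Z\<in>set Q. finite Z)"

definition query_vars :: "'v query \<Rightarrow> 'v set" where
  "query_vars Q = \<Union> (set Q)"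

definition is_instance :: "'v query \<Rightarrow> ('v, 'a) db_instance \<Rightarrow> bool" where
  "is_instance Q I \<longleftrightarrow> (\<forall>i<length Q. finite (I i) \<and> (\<forall>t\<in>I i. dom t = Q ! i))"

definition query_result :: "'v query \<Rightarrow> ('v, 'a) db_instance \<Rightarrow> ('v, 'a) relation" where
  "query_result Q I = {t. dom t = query_vars Q \<and> (\<forall>i<length Q. t |` (Q ! i) \<in> I i)}"

definition projection :: "'v set \<Rightarrow> ('v, 'a) relation \<Rightarrow> ('v, 'a) relation" where
  "projection Y R = (\<lambda>t. t |` Y) ` R"

definition selection :: "'v set \<Rightarrow> ('v \<rightharpoonup> 'a) \<Rightarrow> ('v, 'a) relation \<Rightarrow> ('v, 'a) relation" where
  "selection X x R = {t \<in> R. t |` X = x}"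

text \<open>
  Degrees are extended naturals, so that the maxima and minima below are suprema and infima in a
  complete lattice. For finite relations the supremum in \<open>max_degree\<close> is a maximum; the infimum in
  \<open>partition_degree\<close> is a minimum whenever some partition exists. If \<open>\<X>\<close> is empty, there is none
  unless \<open>R\<close> is empty, and then the value is \<open>\<infinity>\<close>.
\<close>

definition max_degree :: "('v, 'a) relation \<Rightarrow> 'v set \<Rightarrow> 'v set \<Rightarrow> enat" where
  "max_degree R X Y = (SUP x\<in>{x. dom x = X}. enat (card (projection Y (selection X x R))))"

definition partitions :: "'v set set \<Rightarrow> ('v, 'a) relation \<Rightarrow> ('v set \<Rightarrow> ('v, 'a) relation) set" where
  "partitions \<X> R = {F. disjoint_family_on F \<X> \<and> (\<Union>X\<in>\<X>. F X) = R}"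

definition partition_degree :: "('v, 'a) relation \<Rightarrow> 'v set set \<Rightarrow> 'v set \<Rightarrow> enat" where
  "partition_degree R \<X> Y = (INF F\<in>partitions \<X> R. SUP X\<in>\<X>. max_degree (F X) X Y)"

datatype 'v degree_constraint =
  DC (dc_rel: nat) (dc_cond: "'v set") (dc_vars: "'v set") (dc_bound: nat)

datatype 'v partition_constraint =
  PC (pc_rel: nat) (pc_conds: "'v set set") (pc_vars: "'v set") (pc_bound: nat)

definition wf_dc :: "'v query \<Rightarrow> 'v degree_constraint \<Rightarrow> bool" where
  "wf_dc Q c \<longleftrightarrow> dc_rel c < length Q \<and> dc_cond c \<subseteq> dc_vars c \<and> dc_vars c \<subseteq> Q ! dc_rel c"

definition wf_pc :: "'v query \<Rightarrow> 'v partition_constraint \<Rightarrow> bool" where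
  "wf_pc Q p \<longleftrightarrow> pc_rel p < length Q \<and> pc_conds p \<subseteq> Pow (pc_vars p) \<and> pc_vars p \<subseteq> Q ! pc_rel p"

definition satisfies_dcs :: "('v, 'a) db_instance \<Rightarrow> 'v degree_constraint set \<Rightarrow> bool" where
  "satisfies_dcs I \<C> \<longleftrightarrow>
     (\<forall>c\<in>\<C>. max_degree (I (dc_rel c)) (dc_cond c) (dc_vars c) \<le> enat (dc_bound c))"

definition satisfies_pcs :: "('v, 'a) db_instance \<Rightarrow> 'v partition_constraint set \<Rightarrow> bool" where
  "satisfies_pcs I \<P> \<longleftrightarrow>
     (\<forall>p\<in>\<P>. partition_degree (I (pc_rel p)) (pc_conds p) (pc_vars p) \<le> enat (pc_bound p))"

text \<open>
  Every variable of the query lies in some atom with a cardinality constraint, i.e. a degree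
  constraint conditioned on the empty set and bounding all variables of the atom. As a partition
  constraint, a cardinality constraint has \<open>{{}}\<close> as its family of conditioning sets.
\<close>

definition dc_covered :: "'v query \<Rightarrow> 'v degree_constraint set \<Rightarrow> bool" where
  "dc_covered Q \<C> \<longleftrightarrow>
     (\<forall>v\<in>query_vars Q. \<exists>i d. i < length Q \<and> v \<in> Q ! i \<and> DC i {} (Q ! i) d \<in> \<C>)"

definition pc_covered :: "'v query \<Rightarrow> 'v partition_constraint set \<Rightarrow> bool" where
  "pc_covered Q \<P> \<longleftrightarrow>
     (\<forall>v\<in>query_vars Q. \<exists>i d. i < length Q \<and> v \<in> Q ! i \<and> PC i {{}} (Q ! i) d \<in> \<P>)"

text \<open>
  The type argument fixes the domain of values of the database instances. Without the covering
  condition no finite bound exists in general.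
\<close>

definition cardinality_bound ::
    "'a itself \<Rightarrow> ('v query \<Rightarrow> 'v degree_constraint set \<Rightarrow> real) \<Rightarrow> bool" where
  "cardinality_bound (_ :: 'a itself) CB \<longleftrightarrow>
     (\<forall>Q \<C>. wf_query Q \<and> finite \<C> \<and> (\<forall>c\<in>\<C>. wf_dc Q c) \<and> dc_covered Q \<C> \<longrightarrow>
       (\<forall>I :: ('v, 'a) db_instance. is_instance Q I \<and> satisfies_dcs I \<C> \<longrightarrow>
         real (card (query_result Q I)) \<le> CB Q \<C>))"

text \<open>
  A function \<open>\<phi> \<in> Pi\<^sub>E \<P> pc_conds\<close> chooses one conditioning set for each partition constraint.
\<close>

definition pc_extension ::
    "('v query \<Rightarrow> 'v degree_constraint set \<Rightarrow> real) \<Rightarrow>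
     'v query \<Rightarrow> 'v partition_constraint set \<Rightarrow> real" where
  "pc_extension CB Q \<P> =
     (\<Sum>\<phi>\<in>Pi\<^sub>E \<P> pc_conds. CB Q ((\<lambda>p. DC (pc_rel p) (\<phi> p) (pc_vars p) (pc_bound p)) ` \<P>))"

end

theory Submission
  imports Defs
begin

text \<open>
  Fix for every partition constraint a partition witnessing it. Intersecting the chosen parts, each
  choice \<open>\<phi>\<close> of conditioning sets yields a subinstance that satisfies the degree constraints
  belonging to \<open>\<phi>\<close>. Every tuple of the join restricts to exactly one part of each partition, so the
  join is the union over \<open>\<phi>\<close> of the joins of the subinstances, and the bounds add up.
\<close>

text \<open>Passing to a subset shrinks every selected and projected set. Finiteness of
  \<open>R\<close> keeps \<open>card\<close> monotone, since an infinite set has \<open>card\<close>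
  0.\<close>

lemma max_degree_mono:
  assumes "finite R" "S \<subseteq> R"
  shows "max_degree S X Y \<le> max_degree R X Y"
  unfolding max_degree_def
proof (rule SUP_mono)
  fix x :: "'a \<rightharpoonup> 'b"
  assume "x \<in> {x. dom x = X}"
  moreover have "card (projection Y (selection X x S)) \<le> card (projection Y (selection X x R))"
    using assms by (intro card_mono) (auto simp: projection_def selection_def)
  ultimately show "\<exists>z\<in>{x. dom x = X}. enat (card (projection Y (selection X x S)))
      \<le> enat (card (projection Y (selection X z R)))"
    by auto
qed

text \<open>Turns the infimum into an actual partition. Values are extended naturals, so a bound by
  \<open>d\<close> is a strict bound by \<open>Suc d\<close>, and a strict bound on an infimum is
  already met by one member.\<close>

lemma partition_degree_leE:
  assumes "partition_degree R \<X> Y \<le> enat d"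
  obtains F where "F \<in> partitions \<X> R" "\<And>X. X \<in> \<X> \<Longrightarrow> max_degree (F X) X Y \<le> enat d"
proof -
  have "(INF F\<in>partitions \<X> R. SUP X\<in>\<X>. max_degree (F X) X Y) < enat (Suc d)"
    using assms unfolding partition_degree_def by (rule le_less_trans) simp
  then obtain F where F: "F \<in> partitions \<X> R"
      and less: "(SUP X\<in>\<X>. max_degree (F X) X Y) < enat (Suc d)"
    unfolding INF_less_iff by blast
  have "max_degree (F X) X Y \<le> enat d" if "X \<in> \<X>" for X
  proof -
    have "max_degree (F X) X Y < enat (Suc d)"
      using SUP_upper[OF that, of "\<lambda>X. max_degree (F X) X Y"] less by (rule le_less_trans)
    then show ?thesis
      by (cases "max_degree (F X) X Y") auto
  qed
  with F show ?thesis by (rule that)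
qed

text \<open>Several constraints may concern the same atom, so all their chosen parts are
  intersected; an atom without constraints keeps its whole relation.\<close>

definition subinstance ::
    "('v, 'a) db_instance \<Rightarrow> 'v partition_constraint set \<Rightarrow>
     ('v partition_constraint \<Rightarrow> 'v set \<Rightarrow> ('v, 'a) relation) \<Rightarrow>
     ('v partition_constraint \<Rightarrow> 'v set) \<Rightarrow> ('v, 'a) db_instance" where
  "subinstance I \<P> F \<phi> i = {t \<in> I i. \<forall>p\<in>\<P>. pc_rel p = i \<longrightarrow> t \<in> F p (\<phi> p)}"

lemma is_instance_subinstance:
  "is_instance Q I \<Longrightarrow> is_instance Q (subinstance I \<P> F \<phi>)"
  by (auto simp: is_instance_def subinstance_def)

text \<open>The parts cover each relation, so the restriction of a joined tuple to the atom of
  \<open>p\<close> lies in some part; choosing one for each \<open>p\<close> gives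
  \<open>\<phi>\<close>. Conversely, subinstances only remove tuples. If some
  \<open>pc_conds p\<close> is empty, the relation of \<open>p\<close> is empty and so are both
  sides.\<close>

lemma query_result_eq_UN_subinstance:
  assumes "\<And>p. p \<in> \<P> \<Longrightarrow> pc_rel p < length Q"
    and "\<And>p. p \<in> \<P> \<Longrightarrow> F p \<in> partitions (pc_conds p) (I (pc_rel p))"
  shows "query_result Q I = (\<Union>\<phi>\<in>Pi\<^sub>E \<P> pc_conds. query_result Q (subinstance I \<P> F \<phi>))"
proof
  show "query_result Q I \<subseteq> (\<Union>\<phi>\<in>Pi\<^sub>E \<P> pc_conds. query_result Q (subinstance I \<P> F \<phi>))"
  proof
    fix t assume t: "t \<in> query_result Q I"
    have "\<exists>X\<in>pc_conds p. t |` (Q ! pc_rel p) \<in> F p X" if "p \<in> \<P>" for p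
    proof -
      have "t |` (Q ! pc_rel p) \<in> I (pc_rel p)"
        using t assms(1)[OF that] by (simp add: query_result_def)
      then show ?thesis
        using assms(2)[OF that] by (auto simp: partitions_def)
    qed
    then obtain f where f: "\<And>p. p \<in> \<P> \<Longrightarrow> f p \<in> pc_conds p \<and> t |` (Q ! pc_rel p) \<in> F p (f p)"
      by metis
    \<comment> \<open>Extensional functions must be \<open>undefined\<close> outside
      \<open>\<P>\<close>, hence the restriction.\<close>
    then have "restrict f \<P> \<in> Pi\<^sub>E \<P> pc_conds"
      by auto
    moreover have "t \<in> query_result Q (subinstance I \<P> F (restrict f \<P>))"
      using t f by (auto simp: query_result_def subinstance_def)
    ultimately show "t \<in> (\<Union>\<phi>\<in>Pi\<^sub>E \<P> pc_conds. query_result Q (subinstance I \<P> F \<phi>))"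
      by blast
  qed
qed (auto simp: query_result_def subinstance_def)

text \<open>On the atom of \<open>p\<close> the subinstance lies inside the chosen part
  \<open>F p (\<phi> p)\<close>, whose degree is bounded, and degrees are monotone.\<close>

lemma satisfies_dcs_subinstance:
  assumes "is_instance Q I"
    and "\<And>p. p \<in> \<P> \<Longrightarrow> pc_rel p < length Q"
    and "\<And>p. p \<in> \<P> \<Longrightarrow> F p \<in> partitions (pc_conds p) (I (pc_rel p))"
    and "\<And>p X. p \<in> \<P> \<Longrightarrow> X \<in> pc_conds p \<Longrightarrow>
           max_degree (F p X) X (pc_vars p) \<le> enat (pc_bound p)"
    and "\<phi> \<in> Pi\<^sub>E \<P> pc_conds"
  shows "satisfies_dcs (subinstance I \<P> F \<phi>)
           ((\<lambda>p. DC (pc_rel p) (\<phi> p) (pc_vars p) (pc_bound p)) ` \<P>)"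
proof -
  have "max_degree (subinstance I \<P> F \<phi> (pc_rel p)) (\<phi> p) (pc_vars p) \<le> enat (pc_bound p)"
    if p: "p \<in> \<P>" for p
  proof -
    have X: "\<phi> p \<in> pc_conds p"
      using assms(5) p by blast
    have "F p (\<phi> p) \<subseteq> I (pc_rel p)"
      using assms(3)[OF p] X by (auto simp: partitions_def)
    moreover have "finite (I (pc_rel p))"
      using assms(1) assms(2)[OF p] by (simp add: is_instance_def)
    ultimately have "finite (F p (\<phi> p))"
      by (rule finite_subset)
    then have "max_degree (subinstance I \<P> F \<phi> (pc_rel p)) (\<phi> p) (pc_vars p)
        \<le> max_degree (F p (\<phi> p)) (\<phi> p) (pc_vars p)"
      by (rule max_degree_mono) (use p in \<open>auto simp: subinstance_def\<close>)
    also have "\<dots> \<le> enat (pc_bound p)"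
      using assms(4) p X by blast
    finally show ?thesis .
  qed
  then show ?thesis
    by (simp add: satisfies_dcs_def)
qed

text \<open>A cardinality constraint offers \<open>{}\<close> as its only conditioning set, so every
  choice turns it into the corresponding degree constraint.\<close>

lemma dc_covered_choice:
  assumes "pc_covered Q \<P>" "\<phi> \<in> Pi\<^sub>E \<P> pc_conds"
  shows "dc_covered Q ((\<lambda>p. DC (pc_rel p) (\<phi> p) (pc_vars p) (pc_bound p)) ` \<P>)"
  unfolding dc_covered_def
proof
  fix v assume "v \<in> query_vars Q"
  then obtain i d where *: "i < length Q" "v \<in> Q ! i" "PC i {{}} (Q ! i) d \<in> \<P>"
    using assms(1) unfolding pc_covered_def by blast
  then have "\<phi> (PC i {{}} (Q ! i) d) = {}"
    using assms(2) by (auto dest: PiE_mem)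
  then have "DC i {} (Q ! i) d \<in> (\<lambda>p. DC (pc_rel p) (\<phi> p) (pc_vars p) (pc_bound p)) ` \<P>"
    using *(3) by (intro image_eqI[where x = "PC i {{}} (Q ! i) d"]) auto
  with * show "\<exists>i d. i < length Q \<and> v \<in> Q ! i \<and>
      DC i {} (Q ! i) d \<in> (\<lambda>p. DC (pc_rel p) (\<phi> p) (pc_vars p) (pc_bound p)) ` \<P>"
    by blast
qed

text \<open>Makes the set of choices \<open>\<phi>\<close>, the index set of the sum,
  finite.\<close>

lemma finite_pc_conds:
  assumes "wf_query Q" "wf_pc Q p"
  shows "finite (pc_conds p)"
proof -
  have "finite (Q ! pc_rel p)"
    using assms by (simp add: wf_query_def wf_pc_def)
  then show ?thesis
    using assms(2) unfolding wf_pc_def by (meson finite_Pow_iff finite_subset)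
qed

lemma cardinality_boundD:
  fixes I :: "('v, 'a) db_instance"
  assumes "cardinality_bound TYPE('a) CB" "wf_query Q"
    and "finite \<C>" "\<forall>c\<in>\<C>. wf_dc Q c" "dc_covered Q \<C>"
    and "is_instance Q I" "satisfies_dcs I \<C>"
  shows "real (card (query_result Q I)) \<le> CB Q \<C>"
  by (rule assms(1)[unfolded cardinality_bound_def, rule_format])
    (use assms(2-7) in \<open>simp_all\<close>)

theorem proposition18:
  fixes Q :: "'v query"
    and \<P> :: "'v partition_constraint set"
    and CB :: "'v query \<Rightarrow> 'v degree_constraint set \<Rightarrow> real"
  assumes "wf_query Q"
    and "finite \<P>"
    and "\<forall>p\<in>\<P>. wf_pc Q p"
    and "pc_covered Q \<P>"
    and "cardinality_bound TYPE('a) CB"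
  shows "\<forall>I :: ('v, 'a) db_instance. is_instance Q I \<and> satisfies_pcs I \<P> \<longrightarrow>
           real (card (query_result Q I)) \<le> pc_extension CB Q \<P>"
proof (intro allI impI, elim conjE)
  fix I :: "('v, 'a) db_instance"
  assume I: "is_instance Q I" and sat: "satisfies_pcs I \<P>"
  \<comment> \<open>Different choices may give the same set \<open>?C \<phi>\<close>; they still
    count separately, because the sum ranges over \<open>\<phi>\<close>.\<close>
  let ?C = "\<lambda>\<phi>. (\<lambda>p. DC (pc_rel p) (\<phi> p) (pc_vars p) (pc_bound p)) ` \<P>"
  have rel: "pc_rel p < length Q" if "p \<in> \<P>" for p
    using assms(3) that by (simp add: wf_pc_def)
  have "\<exists>F. F \<in> partitions (pc_conds p) (I (pc_rel p)) \<and>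
      (\<forall>X\<in>pc_conds p. max_degree (F X) X (pc_vars p) \<le> enat (pc_bound p))" if "p \<in> \<P>" for p
    using sat that unfolding satisfies_pcs_def by (meson partition_degree_leE)
  then obtain F where part: "\<And>p. p \<in> \<P> \<Longrightarrow> F p \<in> partitions (pc_conds p) (I (pc_rel p))"
    and deg: "\<And>p X. p \<in> \<P> \<Longrightarrow> X \<in> pc_conds p \<Longrightarrow>
      max_degree (F p X) X (pc_vars p) \<le> enat (pc_bound p)"
    by metis
  have fin: "finite (Pi\<^sub>E \<P> pc_conds)"
    using assms(1-3) by (auto intro!: finite_PiE finite_pc_conds)
  \<comment> \<open>\<open>CB\<close> bounds only well-formed, finite, covering sets of constraints,
    so these properties are checked for \<open>?C \<phi>\<close>.\<close>
  have bound: "real (card (query_result Q (subinstance I \<P> F \<phi>))) \<le> CB Q (?C \<phi>)"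
    if \<phi>: "\<phi> \<in> Pi\<^sub>E \<P> pc_conds" for \<phi>
  proof -
    have "\<forall>c\<in>?C \<phi>. wf_dc Q c"
    proof
      fix c assume "c \<in> ?C \<phi>"
      then obtain p where p: "p \<in> \<P>" and c: "c = DC (pc_rel p) (\<phi> p) (pc_vars p) (pc_bound p)"
        by blast
      have "\<phi> p \<in> pc_conds p" "wf_pc Q p"
        using PiE_mem[OF \<phi> p] assms(3) p by auto
      then show "wf_dc Q c"
        unfolding c wf_dc_def wf_pc_def by auto
    qed
    moreover have "finite (?C \<phi>)"
      using assms(2) by simp
    moreover have "dc_covered Q (?C \<phi>)"
      using assms(4) \<phi> by (rule dc_covered_choice)
    moreover have "is_instance Q (subinstance I \<P> F \<phi>)"
      using I by (rule is_instance_subinstance)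
    moreover have "satisfies_dcs (subinstance I \<P> F \<phi>) (?C \<phi>)"
      by (rule satisfies_dcs_subinstance[OF I rel part deg \<phi>])
    ultimately show ?thesis
      using cardinality_boundD[OF assms(5,1)] by blast
  qed
  have "card (query_result Q I)
      = card (\<Union>\<phi>\<in>Pi\<^sub>E \<P> pc_conds. query_result Q (subinstance I \<P> F \<phi>))"
    using query_result_eq_UN_subinstance[OF rel part] by (rule arg_cong)
  \<comment> \<open>Union bound over the finitely many choices; each summand is then compared with
    \<open>CB\<close> by \<open>bound\<close>.\<close>
  also have "\<dots> \<le> (\<Sum>\<phi>\<in>Pi\<^sub>E \<P> pc_conds. card (query_result Q (subinstance I \<P> F \<phi>)))"
    using fin by (rule card_UN_le)
  finally have "real (card (query_result Q I))
      \<le> real (\<Sum>\<phi>\<in>Pi\<^sub>E \<P> pc_conds. card (query_result Q (subinstance I \<P> F \<phi>)))"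
    by (rule of_nat_mono)
  also have "\<dots> \<le> pc_extension CB Q \<P>"
    unfolding pc_extension_def of_nat_sum by (intro sum_mono bound)
  finally show "real (card (query_result Q I)) \<le> pc_extension CB Q \<P>" .
qed

end
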